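(* Let $X,Y$ be topological spaces and let $f,g:X\to Y$ be continuous maps. If $f$ is homotopic to $g$, then $\mathrm{cat}(f)=\mathrm{cat}(g)$.
   Context: Homotopies are free (no base points). A continuous map is null-homotopic if it is homotopic to a constant map. The category $\mathrm{cat}(f)$ of a continuous map $f:X\to Y$ is the least positive integer $n$ such that $X$ is a union of open subsets $U_1,\dots,U_n$ with each restriction $f_{|U_i}:U_i\to Y$ null-homotopic, and $\infty$ if no such integer exists. *)

theory Defs
  imports "HOL-Analysis.Analysis"
begin

(* Continuity of f is part of homotopic_with.  The point c automatically lies in
   topspace Y unless topspace X is empty; as for contractible_space, the empty map
   then counts as constant, even into the empty space. *)
definition null_homotopic :: "'a topology \<Rightarrow> 'b topology \<Rightarrow> ('a \<Rightarrow> 'b) \<Rightarrow> bool" where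
  "null_homotopic X Y f \<longleftrightarrow> (\<exists>c. homotopic_with (\<lambda>h. True) X Y f (\<lambda>x. c))"

definition cat_cover ::
    "'a topology \<Rightarrow> 'b topology \<Rightarrow> ('a \<Rightarrow> 'b) \<Rightarrow> nat \<Rightarrow> (nat \<Rightarrow> 'a set) \<Rightarrow> bool" where
  "cat_cover X Y f n U \<longleftrightarrow>
     (\<forall>i\<in>{1..n}. openin X (U i) \<and> null_homotopic (subtopology X (U i)) Y f) \<and>
     topspace X = (\<Union>i\<in>{1..n}. U i)"

definition cat :: "'a topology \<Rightarrow> 'b topology \<Rightarrow> ('a \<Rightarrow> 'b) \<Rightarrow> enat" where
  "cat X Y f =
     (if \<exists>n\<ge>1. \<exists>U. cat_cover X Y f n U
      then enat (LEAST n. 1 \<le> n \<and> (\<exists>U. cat_cover X Y f n U))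
      else \<infinity>)"

end

theory Submission
  imports Defs
begin

text \<open>A homotopy from \<open>f\<close> to \<open>g\<close> restricts to every open subset, and
  homotopic maps are null-homotopic together. So a cover is categorical for \<open>f\<close> exactly
  when it is for \<open>g\<close>.\<close>

text \<open>Restriction to \<open>S\<close> is precomposition with the inclusion, which is
  \<open>id\<close> viewed as a map from \<open>subtopology X S\<close> to \<open>X\<close>.\<close>

lemma homotopic_with_subtopology:
  assumes "homotopic_with (\<lambda>h. True) X Y f g"
  shows "homotopic_with (\<lambda>h. True) (subtopology X S) Y f g"
  using homotopic_with_compose_continuous_map_right
    [OF assms continuous_map_id_subt[of X S], of "\<lambda>h. True"]
  by simp

text \<open>By symmetry and transitivity of homotopy, the same constant \<open>c\<close> serves both
  maps.\<close>

lemma null_homotopic_homotopic: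
  assumes "homotopic_with (\<lambda>h. True) X Y f g"
  shows "null_homotopic X Y f \<longleftrightarrow> null_homotopic X Y g"
  unfolding null_homotopic_def
  using assms by (meson homotopic_with_symD homotopic_with_trans)

theorem mainTheorem8:
  fixes X :: "'a topology" and Y :: "'b topology" and f g :: "'a \<Rightarrow> 'b"
  assumes "continuous_map X Y f" and "continuous_map X Y g"
    and "homotopic_with (\<lambda>h. True) X Y f g"
  shows "cat X Y f = cat X Y g"
proof -
  have "null_homotopic (subtopology X S) Y f \<longleftrightarrow> null_homotopic (subtopology X S) Y g" for S
    by (rule null_homotopic_homotopic[OF homotopic_with_subtopology[OF assms(3)]])
  \<comment> \<open>Equality as predicates in \<open>n\<close> and \<open>U\<close> settles the
    finite and the infinite case of \<open>cat\<close> at once.\<close>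
  then have "cat_cover X Y f = cat_cover X Y g"
    by (simp add: cat_cover_def fun_eq_iff)
  then show ?thesis
    by (simp add: cat_def)
qed

end
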